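(* Let $G$ be a $\mathfrak{C}_7$-group. Then $G$ is a $p$-group for some prime number $p$ if and only if $G\cong (C_2)^6$ or $G\cong (C_3)^4$.
   Context: $(C_k)^m$ denotes the direct product of $m$ copies of the cyclic group $C_k$ of order $k$. A cover for a group $G$ is a set $\mathcal{C}$ of proper subgroups of $G$ whose set-theoretic union is $G$. It is irredundant if no proper subset of $\mathcal{C}$ is a cover for $G$, maximal if all members of $\mathcal{C}$ are maximal subgroups of $G$, and core-free if $D=\bigcap_{M\in\mathcal{C}}M$ is core-free in $G$, i.e. $\bigcap_{g\in G}g^{-1}Dg=1$. A $\mathfrak{C}_n$-cover for $G$ is an irredundant maximal core-free cover $\mathcal{C}$ for $G$ with $|\mathcal{C}|=n$; a group having a $\mathfrak{C}_n$-cover is called a $\mathfrak{C}_n$-group. *)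

theory Defs
  imports "HOL-Algebra.Algebra"
begin

definition direct_power_cyclic :: "nat \<Rightarrow> nat \<Rightarrow> (nat \<Rightarrow> int) monoid"
  where "direct_power_cyclic k m = product_group {..<m} (\<lambda>_. integer_mod_group k)"

definition maximal_subgroup :: "'a set \<Rightarrow> ('a, 'b) monoid_scheme \<Rightarrow> bool"
  where "maximal_subgroup M G \<longleftrightarrow>
    subgroup M G \<and> M \<noteq> carrier G \<and>
    (\<forall>H. subgroup H G \<longrightarrow> M \<subseteq> H \<longrightarrow> H = M \<or> H = carrier G)"

definition is_cover :: "('a, 'b) monoid_scheme \<Rightarrow> 'a set set \<Rightarrow> bool"
  where "is_cover G C \<longleftrightarrow>
    (\<forall>M\<in>C. subgroup M G \<and> M \<noteq> carrier G) \<and> \<Union>C = carrier G"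

definition irredundant_cover :: "('a, 'b) monoid_scheme \<Rightarrow> 'a set set \<Rightarrow> bool"
  where "irredundant_cover G C \<longleftrightarrow> is_cover G C \<and> (\<forall>C'. C' \<subset> C \<longrightarrow> \<not> is_cover G C')"

definition maximal_cover :: "('a, 'b) monoid_scheme \<Rightarrow> 'a set set \<Rightarrow> bool"
  where "maximal_cover G C \<longleftrightarrow> is_cover G C \<and> (\<forall>M\<in>C. maximal_subgroup M G)"

definition normal_core :: "('a, 'b) monoid_scheme \<Rightarrow> 'a set \<Rightarrow> 'a set"
  where "normal_core G D =
    (\<Inter>g\<in>carrier G. (\<lambda>d. inv\<^bsub>G\<^esub> g \<otimes>\<^bsub>G\<^esub> d \<otimes>\<^bsub>G\<^esub> g) ` D)"

text \<open>A cover of a group is nonempty, so \<open>\<Inter>C\<close> below is never the intersection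
  of the empty family.\<close>

definition core_free_cover :: "('a, 'b) monoid_scheme \<Rightarrow> 'a set set \<Rightarrow> bool"
  where "core_free_cover G C \<longleftrightarrow> is_cover G C \<and> normal_core G (\<Inter>C) = {\<one>\<^bsub>G\<^esub>}"

definition C_cover :: "nat \<Rightarrow> ('a, 'b) monoid_scheme \<Rightarrow> 'a set set \<Rightarrow> bool"
  where "C_cover n G C \<longleftrightarrow>
    irredundant_cover G C \<and> maximal_cover G C \<and> core_free_cover G C \<and>
    finite C \<and> card C = n"

definition C_group :: "nat \<Rightarrow> ('a, 'b) monoid_scheme \<Rightarrow> bool"
  where "C_group n G \<longleftrightarrow> group G \<and> (\<exists>C. C_cover n G C)"

text \<open>The general notion of a \<open>p\<close>-group, which does not presuppose finiteness.
  Since \<^const>\<open>group.ord\<close> is \<open>0\<close> on elements of infinite order, such elements are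
  excluded.\<close>

definition p_group :: "nat \<Rightarrow> ('a, 'b) monoid_scheme \<Rightarrow> bool"
  where "p_group p G \<longleftrightarrow>
    group G \<and> Factorial_Ring.prime p \<and> (\<forall>x\<in>carrier G. \<exists>k. group.ord G x = p ^ k)"

end

(* By the argument of B. H. Neumann, the members of a finite irredundant cover intersect in a
   subgroup of finite index, so a group with a core-free such cover is finite. In a finite p-group
   the maximal subgroups are kernels of homomorphisms onto Z/p, so the group embeds into a power
   of Z/p and the cover becomes a family of 7 linear functionals.

   Let n(x) be the number of functionals vanishing at x. The coset argument in card_zeros_le shows
   1 <= n(x) <= 7 - p for nontrivial x, so p < 7 and any 8 - p of the functionals separate points.
   For p = 2, products of elements lying in exactly one kernel show that any six functionals are
   independent. For p = 5 and p = 3 the sums of n(x) and n(x)^2 over the group are known multiples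
   of its order N: summing (n - 1)(n - 2) gives 22 N = 750 when p = 5, and summing (n - 2)(n - 3)
   gives N >= 36 when p = 3. In the latter case five functionals separate points, so N is 3^4 or
   3^5, and if N = 3^5 any five functionals are independent, which contradicts the count of
   binomial sums of n. *)

theory Submission
  imports Defs
begin

subsection \<open>Finite irredundant covers\<close>

lemma (in group) inv_mult_cancel_left:
  "\<lbrakk>a \<in> carrier G; x \<in> carrier G\<rbrakk> \<Longrightarrow> inv a \<otimes> (a \<otimes> x) = x"
  "\<lbrakk>a \<in> carrier G; x \<in> carrier G\<rbrakk> \<Longrightarrow> a \<otimes> (inv a \<otimes> x) = x"
  by (simp_all add: m_assoc[symmetric])

text \<open>B. H. Neumann's argument. Since \<open>inv f \<otimes> x \<in> \<Inter>C\<close> puts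
  \<open>x\<close> into the left coset of \<open>f\<close>, the set \<open>F\<close> meets every
  left coset of \<open>\<Inter>C\<close>, which therefore has finite index.\<close>

lemma (in group) finite_index_Inter_of_irredundant:
  assumes fin: "finite C" and sub: "\<And>M. M \<in> C \<Longrightarrow> subgroup M G"
    and cover: "\<Union>C = carrier G" and irr: "\<And>C'. C' \<subset> C \<Longrightarrow> \<Union>C' \<noteq> carrier G"
  obtains F where "finite F" "F \<subseteq> carrier G" "\<And>x. x \<in> carrier G \<Longrightarrow> \<exists>f\<in>F. inv f \<otimes> x \<in> \<Inter>C"
proof -
  have "C \<noteq> {}"
    using cover one_closed by auto
  then have D: "subgroup (\<Inter>C) G"
    using sub subgroups_Inter by blast
  \<comment> \<open>If \<open>a \<notin> \<Union>S\<close>, the coset \<open>a (\<Inter>S)\<close> is covered by \<open>C - S\<close>, hence by finitely many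
    cosets of the groups \<open>\<Inter>(insert M S)\<close>.\<close>
  have "\<exists>F. finite F \<and> F \<subseteq> carrier G \<and> (\<forall>x\<in>carrier G \<inter> \<Inter>S. \<exists>f\<in>F. inv f \<otimes> x \<in> \<Inter>C)"
    if "S \<subseteq> C" for S
    using that
  proof (induction "card (C - S)" arbitrary: S rule: less_induct)
    case less
    show ?case
    proof (cases "S = C")
      case True
      then show ?thesis
        using subgroup.subset[OF D] by (intro exI[of _ "{\<one>}"]) auto
    next
      case False
      with less.prems have "S \<subset> C" by auto
      then have "\<Union>S \<noteq> carrier G" "\<Union>S \<subseteq> carrier G"
        using irr cover by auto
      then obtain a where a: "a \<in> carrier G" "a \<notin> \<Union>S" by auto
      have "\<exists>F. finite F \<and> F \<subseteq> carrier G \<and> (\<forall>x\<in>carrier G \<inter> \<Inter>(insert M S). \<exists>f\<in>F. inv f \<otimes> x \<in> \<Inter>C)"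
        if "M \<in> C - S" for M
      proof (rule less.hyps)
        show "card (C - insert M S) < card (C - S)"
          using that fin by (intro psubset_card_mono) auto
        show "insert M S \<subseteq> C" using that less.prems by auto
      qed
      then obtain F where F: "\<And>M. M \<in> C - S \<Longrightarrow> finite (F M) \<and> F M \<subseteq> carrier G \<and>
          (\<forall>x\<in>carrier G \<inter> \<Inter>(insert M S). \<exists>f\<in>F M. inv f \<otimes> x \<in> \<Inter>C)"
        by metis
      \<comment> \<open>If \<open>x\<close> is another element of \<open>\<Inter>S\<close> with
        \<open>a \<otimes> x \<in> M\<close>, then \<open>inv (b M) \<otimes> x\<close> lies in
        \<open>M\<close> and in all members of \<open>S\<close>. So \<open>F M\<close> provides
        representatives after translation by \<open>b M\<close>. The choice is meaningful only for
        \<open>M \<in> E\<close>.\<close>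
      define b where "b M = (SOME b. b \<in> carrier G \<inter> \<Inter>S \<and> a \<otimes> b \<in> M)" for M
      define E where "E = {M \<in> C - S. b M \<in> carrier G \<inter> \<Inter>S \<and> a \<otimes> b M \<in> M}"
      have "finite E" using fin by (simp add: E_def)
      let ?F = "\<Union>M\<in>E. (\<lambda>f. b M \<otimes> f) ` F M"
      have "\<exists>f\<in>?F. inv f \<otimes> x \<in> \<Inter>C" if x: "x \<in> carrier G \<inter> \<Inter>S" for x
      proof -
        have "a \<otimes> x \<in> \<Union>C" using a x cover by auto
        then obtain M where M: "M \<in> C" "a \<otimes> x \<in> M" by auto
        \<comment> \<open>As \<open>x\<close> lies in every member of \<open>S\<close>, having
          \<open>M \<in> S\<close> would put \<open>a\<close> into \<open>M\<close>.\<close>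
        have "M \<notin> S"
        proof
          assume "M \<in> S"
          then have "x \<in> M" using x by auto
          then have "(a \<otimes> x) \<otimes> inv x \<in> M"
            using M sub subgroup.m_closed subgroup.m_inv_closed by metis
          then show False using a x \<open>M \<in> S\<close> by (simp add: m_assoc) 
        qed
        have "\<exists>b. b \<in> carrier G \<inter> \<Inter>S \<and> a \<otimes> b \<in> M"
          using x M by blast
        then have b: "b M \<in> carrier G \<inter> \<Inter>S \<and> a \<otimes> b M \<in> M"
          unfolding b_def by (rule someI_ex)
        then have "M \<in> E" using M \<open>M \<notin> S\<close> by (simp add: E_def)
        have "inv (b M) \<otimes> x \<in> N" if "N \<in> S" for N
        proof -
          have "subgroup N G" using that less.prems sub by auto
          then show ?thesis using b x that
            by (meson IntD2 InterE subgroup.m_closed subgroup.m_inv_closed)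
        qed
        moreover have "inv (a \<otimes> b M) \<otimes> (a \<otimes> x) \<in> M"
          using b M sub subgroup.m_closed subgroup.m_inv_closed by metis
        moreover have "inv (a \<otimes> b M) \<otimes> (a \<otimes> x) = inv (b M) \<otimes> x"
          using a b x by (simp add: inv_mult_group m_assoc inv_mult_cancel_left)
        ultimately have "inv (b M) \<otimes> x \<in> carrier G \<inter> \<Inter>(insert M S)"
          using b x by auto
        moreover have "M \<in> C - S" using M \<open>M \<notin> S\<close> by simp
        ultimately obtain f where f: "f \<in> F M" "f \<in> carrier G" "inv f \<otimes> (inv (b M) \<otimes> x) \<in> \<Inter>C"
          using F[of M] by (meson subsetD)
        moreover have "inv f \<otimes> (inv (b M) \<otimes> x) = inv (b M \<otimes> f) \<otimes> x"
          using f b x by (simp add: inv_mult_group m_assoc)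
        ultimately show ?thesis using \<open>M \<in> E\<close> by auto
      qed
      moreover have "finite ?F"
        using \<open>finite E\<close> F unfolding E_def by blast
      moreover have "?F \<subseteq> carrier G"
      proof clarify
        fix M f assume "M \<in> E" "f \<in> F M"
        then show "b M \<otimes> f \<in> carrier G"
          using F[of M] unfolding E_def by blast
      qed
      ultimately show ?thesis
        by (intro exI[of _ ?F]) blast
    qed
  qed
  \<comment> \<open>\<open>\<Inter>{}\<close> is the whole type, so the empty family yields the
    claim for all of \<open>carrier G\<close>.\<close>
  from this[of "{}"] show ?thesis using that by auto
qed

text \<open>The kernel of the action of \<open>G\<close> on the left cosets of \<open>D\<close> is
  the normal core. \<open>\<Phi> x\<close> records how \<open>x\<close> moves the cosets as a map
  from \<open>F\<close> to \<open>F\<close>, so a trivial core makes \<open>\<Phi>\<close> injective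
  into a finite set.\<close>

lemma (in group) finite_of_normal_core_trivial:
  assumes D: "subgroup D G" and core: "normal_core G D = {\<one>}"
    and F: "finite F" "F \<subseteq> carrier G" "\<And>x. x \<in> carrier G \<Longrightarrow> \<exists>f\<in>F. inv f \<otimes> x \<in> D"
  shows "finite (carrier G)"
proof -
  obtain c where c: "\<And>x. x \<in> carrier G \<Longrightarrow> c x \<in> F \<and> inv (c x) \<otimes> x \<in> D"
    using F(3) by metis
  define \<Phi> where "\<Phi> x = (\<lambda>f\<in>F. c (x \<otimes> f))" for x
  have "inj_on \<Phi> (carrier G)"
  proof (rule inj_onI)
    fix x y assume x: "x \<in> carrier G" and y: "y \<in> carrier G" and eq: "\<Phi> x = \<Phi> y"
    have F': "inv f \<otimes> (inv x \<otimes> y) \<otimes> f \<in> D" if "f \<in> F" for f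
    proof -
      have f: "f \<in> carrier G" using that F by auto
      define u where "u = c (x \<otimes> f)"
      have "c (y \<otimes> f) = u"
        using fun_cong[OF eq, of f] that by (simp add: \<Phi>_def u_def)
      then have u: "u \<in> carrier G" "inv u \<otimes> (x \<otimes> f) \<in> D" "inv u \<otimes> (y \<otimes> f) \<in> D"
        using c[of "x \<otimes> f"] c[of "y \<otimes> f"] x y f F(2) unfolding u_def by auto
      then have "inv (inv u \<otimes> (x \<otimes> f)) \<otimes> (inv u \<otimes> (y \<otimes> f)) \<in> D"
        using D subgroup.m_closed subgroup.m_inv_closed by metis
      moreover have "inv (inv u \<otimes> (x \<otimes> f)) \<otimes> (inv u \<otimes> (y \<otimes> f)) = inv f \<otimes> (inv x \<otimes> y) \<otimes> f"
        using u x y f by (simp add: inv_mult_group m_assoc inv_mult_cancel_left)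
      ultimately show ?thesis by simp
    qed
    \<comment> \<open>\<open>F'\<close> covers conjugation by members of \<open>F\<close> only.
      Writing \<open>inv g\<close> as \<open>f\<close> times an element of \<open>D\<close> reduces
      a general \<open>g\<close> to \<open>f\<close>, up to a conjugation inside
      \<open>D\<close>.\<close>
    have conj: "g \<otimes> (inv x \<otimes> y) \<otimes> inv g \<in> D" if g: "g \<in> carrier G" for g
    proof -
      obtain f where f: "f \<in> F" "inv f \<otimes> inv g \<in> D" using F(3)[of "inv g"] g by auto
      have fc: "f \<in> carrier G" using f F by auto
      let ?d = "inv f \<otimes> inv g"
      have "inv ?d \<otimes> (inv f \<otimes> (inv x \<otimes> y) \<otimes> f) \<otimes> ?d \<in> D"
        using F'[OF f(1)] f D subgroup.m_closed subgroup.m_inv_closed by metis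
      moreover have "inv ?d \<otimes> (inv f \<otimes> (inv x \<otimes> y) \<otimes> f) \<otimes> ?d = g \<otimes> (inv x \<otimes> y) \<otimes> inv g"
        using g fc x y by (simp add: inv_mult_group m_assoc inv_mult_cancel_left)
      ultimately show ?thesis by simp
    qed
    have "inv x \<otimes> y \<in> normal_core G D"
      unfolding normal_core_def
    proof (intro INT_I)
      fix g assume g: "g \<in> carrier G"
      have "inv x \<otimes> y = inv g \<otimes> (g \<otimes> (inv x \<otimes> y) \<otimes> inv g) \<otimes> g"
        using g x y by (simp add: m_assoc inv_mult_cancel_left)
      then show "inv x \<otimes> y \<in> (\<lambda>d. inv g \<otimes> d \<otimes> g) ` D"
        using conj[OF g] by blast
    qed
    then have "inv x \<otimes> y = \<one>" using core by simp
    then show "x = y" using x y by (metis inv_closed inv_equality inv_inv)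
  qed
  moreover have "\<Phi> ` carrier G \<subseteq> F \<rightarrow>\<^sub>E F"
    using c F(2) by (auto simp: \<Phi>_def)
  then have "finite (\<Phi> ` carrier G)"
    using F(1) by (meson finite_PiE finite_subset)
  ultimately show ?thesis using finite_imageD by metis 
qed

subsection \<open>Maximal subgroups of finite \<open>p\<close>-groups\<close>

text \<open>\<open>p_group\<close> constrains element orders only. By Sylow, each prime
  \<open>q\<close> dividing the group order is the order of some element, hence a power of
  \<open>p\<close>, so \<open>q = p\<close>.\<close>

lemma (in group) order_p_group:
  assumes fin: "finite (carrier G)" and pg: "p_group p G"
  obtains k where "order G = p ^ k"
proof -
  have p: "Factorial_Ring.prime p" and ordp: "\<And>x. x \<in> carrier G \<Longrightarrow> \<exists>k. ord x = p ^ k"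
    using pg by (auto simp: p_group_def)
  have q: "q = p" if q: "Factorial_Ring.prime q" "q dvd order G" for q
  proof -
    obtain m where "order G = q ^ 1 * m" using q(2) by auto
    then obtain H where H: "subgroup H G" "card H = q ^ 1"
      using sylow_thm[OF q(1) is_group _ fin] by blast
    have "card H > 1" using H(2) prime_gt_1_nat[OF q(1)] by simp
    then have "H \<noteq> {\<one>}" by auto
    moreover have "\<one> \<in> H" using H(1) by (rule subgroup.one_closed)
    ultimately obtain x where x: "x \<in> H" "x \<noteq> \<one>" by auto
    then have xG: "x \<in> carrier G" using H(1) subgroup.mem_carrier by metis
    interpret H: group "G\<lparr>carrier := H\<rparr>" by (rule subgroup_imp_group[OF H(1)])
    have "x [^] q = \<one>"
      using H.pow_order_eq_1[of x] x H(2) nat_pow_consistent[of x q H] by (simp add: order_def)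
    then have "ord x dvd q" using xG pow_eq_id by blast
    moreover have "ord x \<noteq> 1" using x(2) xG ord_eq_1 by blast
    ultimately have "ord x = q" using q(1) prime_nat_iff by blast
    then show ?thesis
      using ordp[OF xG] q(1) p by (metis prime_dvd_power primes_dvd_imp_eq dvd_refl)
  qed
  have "order G > 0" using fin order_gt_0_iff_finite by blast
  moreover have "\<not> is_unit p" using p by (simp add: prime_nat_iff)
  ultimately obtain m where m: "order G = p ^ multiplicity p (order G) * m" "\<not> p dvd m"
    using multiplicity_decompose' by (metis neq0_conv)
  have "m = 1"
  proof (rule ccontr)
    assume "m \<noteq> 1"
    then obtain r where r: "Factorial_Ring.prime r" "r dvd m" using prime_factor_nat by blast
    then have "r dvd order G" using m(1) by (metis dvd_mult)
    then show False using q r m(2) by blast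
  qed
  then show ?thesis using m(1) that by simp
qed

lemma dvd_prime_power_neq_1:
  fixes p :: nat
  assumes "Factorial_Ring.prime p" "n dvd p ^ k" "n \<noteq> 1"
  shows "p dvd n"
proof -
  obtain i where "n = p ^ i" using assms divides_primepow_nat by blast
  then show ?thesis using assms(3) by (cases i) auto
qed

text \<open>If \<open>M\<close> is its own normalizer, then \<open>M\<close> is the only fixed point of its conjugation action on
  the set of its conjugates, whose size is divisible by \<open>p\<close>.\<close>

lemma (in group) maximal_subgroup_normal:
  assumes fin: "finite (carrier G)" and pg: "p_group p G" and max: "maximal_subgroup M G"
  shows "M \<lhd> G"
proof -
  have p: "Factorial_Ring.prime p" using pg by (simp add: p_group_def)
  obtain k where k: "order G = p ^ k" using order_p_group[OF fin pg] .
  have M: "subgroup M G" "M \<noteq> carrier G" and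
    maxD: "\<And>H. \<lbrakk>subgroup H G; M \<subseteq> H\<rbrakk> \<Longrightarrow> H = M \<or> H = carrier G"
    using max by (auto simp: maximal_subgroup_def)
  have Mc: "\<And>m. m \<in> M \<Longrightarrow> m \<in> carrier G" using M(1) subgroup.mem_carrier by metis
  have one: "\<one> \<in> M" using M(1) by (rule subgroup.one_closed)
  \<comment> \<open>The action is on all subgroups. The stabilizer \<open>N\<close> of
    \<open>M\<close> is its normalizer, and the conjugates of \<open>M\<close> form the orbit
    \<open>Orb\<close>.\<close>
  define E where "E = {H. subgroup H G}"
  define \<phi> where "\<phi> g = (\<lambda>H \<in> E. g <# H #> inv g)" for g
  interpret act: group_action G E \<phi>
    unfolding E_def \<phi>_def by (rule action_by_conjugation_on_subgroups_set)
  interpret actM: group_action "G\<lparr>carrier := M\<rparr>" E \<phi>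
    by (rule act.induced_action[OF M(1)])
  have ME: "M \<in> E" using M by (simp add: E_def)
  have mem: "x \<in> \<phi> g H \<longleftrightarrow> inv g \<otimes> x \<otimes> g \<in> H"
    if "g \<in> carrier G" "H \<in> E" "x \<in> carrier G" for g H x
  proof -
    have H: "H \<subseteq> carrier G" using that by (simp add: E_def subgroup.subset)
    have "x = g \<otimes> h \<otimes> inv g \<longleftrightarrow> h = inv g \<otimes> x \<otimes> g" if "h \<in> H" for h
      using that H \<open>g \<in> _\<close> \<open>x \<in> _\<close> by (auto simp: m_assoc inv_mult_cancel_left)
    then show ?thesis using \<open>H \<in> E\<close> by (auto simp: \<phi>_def l_coset_def r_coset_def)
  qed
  have sub: "\<phi> g H \<subseteq> carrier G" if "g \<in> carrier G" "H \<in> E" for g H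
    using act.element_image[OF that refl] by (simp add: E_def subgroup.subset)
  define N where "N = stabilizer G \<phi> M"
  have N: "subgroup N G" unfolding N_def by (rule act.stabilizer_subgroup[OF ME])
  have "M \<subseteq> N"
  proof
    fix m assume m: "m \<in> M"
    have "inv m \<otimes> x \<otimes> m \<in> M \<longleftrightarrow> x \<in> M" if x: "x \<in> carrier G" for x
    proof
      assume "inv m \<otimes> x \<otimes> m \<in> M"
      then have "m \<otimes> (inv m \<otimes> x \<otimes> m) \<otimes> inv m \<in> M"
        using m M(1) subgroup.m_closed subgroup.m_inv_closed by metis
      then show "x \<in> M" using x Mc[OF m] by (simp add: m_assoc inv_mult_cancel_left)
    next
      assume "x \<in> M"
      then show "inv m \<otimes> x \<otimes> m \<in> M"
        using m M(1) subgroup.m_closed subgroup.m_inv_closed by metis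
    qed
    then have "\<phi> m M = M"
      using mem[OF Mc[OF m] ME] sub[OF Mc[OF m] ME] Mc by blast
    then show "m \<in> N" using Mc[OF m] by (simp add: N_def stabilizer_def)
  qed
  then consider "N = M" | "N = carrier G" using maxD[OF N] by blast
  then show ?thesis
  proof cases
    case 2
    show ?thesis
      unfolding normal_inv_iff
    proof (intro conjI M(1) ballI)
      fix g m assume g: "g \<in> carrier G" and m: "m \<in> M"
      have "\<phi> g M = M" using g 2 by (auto simp: N_def stabilizer_def)
      then show "g \<otimes> m \<otimes> inv g \<in> M"
        using mem[OF g ME, of "g \<otimes> m \<otimes> inv g"] g m Mc[OF m]
        by (simp add: m_assoc inv_mult_cancel_left)
    qed
  next
    case 1
    define Orb where "Orb = orbit G \<phi> M"
    have OE: "H \<in> E" if "H \<in> Orb" for H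
      using that act.element_image[OF _ ME] by (auto simp: Orb_def orbit_def)
    have MO: "M \<in> Orb" using act.orbit_refl[OF ME] by (simp add: Orb_def)
    have oc: "card Orb * card M = p ^ k"
      using act.orbit_stabilizer_theorem[OF ME] 1 k by (simp add: Orb_def N_def)
    have "card M < card (carrier G)"
      using fin M(2) Mc by (intro psubset_card_mono) auto
    then have "card Orb \<noteq> 1" using oc k by (auto simp: order_def)
    then have pO: "p dvd card Orb"
      using dvd_prime_power_neq_1[OF p] oc by (metis dvd_triv_left)
    have "finite E"
      by (rule finite_subset[of _ "Pow (carrier G)"]) (use fin in \<open>auto simp: E_def subgroup.subset dest: subgroup.subset\<close>)
    then have finO: "finite Orb" using OE by (meson finite_subset subsetI)
    let ?orb = "\<lambda>H. orbit (G\<lparr>carrier := M\<rparr>) \<phi> H"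
    have orbO: "?orb H \<subseteq> Orb" if "H \<in> Orb" for H
    proof
      fix K assume K: "K \<in> ?orb H"
      then have "K \<in> E" using actM.element_image OE[OF that] by (auto simp: orbit_def)
      moreover have "K \<in> orbit G \<phi> H" using K Mc by (auto simp: orbit_def)
      ultimately show "K \<in> Orb"
        using act.orbit_trans[OF ME OE[OF that]] that by (simp add: Orb_def)
    qed
    have notM: "M \<notin> ?orb H" if "H \<in> Orb" "H \<noteq> M" for H
    proof
      assume "M \<in> ?orb H"
      then have "H \<in> ?orb M" using actM.orbit_sym[OF OE[OF that(1)] ME] by simp
      then obtain m where "m \<in> M" "H = \<phi> m M" by (auto simp: orbit_def)
      then show False using \<open>M \<subseteq> N\<close> that(2) by (auto simp: N_def stabilizer_def)
    qed
    \<comment> \<open>If \<open>M\<close> fixes a conjugate \<open>H = g M g^-1\<close>, then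
      conjugating back by \<open>g\<close> carries \<open>M\<close> into the normalizer of
      \<open>M\<close>, which is \<open>M\<close>. Hence \<open>M \<subseteq> H\<close>, and
      maximality leaves only \<open>H = carrier G\<close>, which would make \<open>M\<close>
      improper.\<close>
    have pdvd: "p dvd card (?orb H)" if H: "H \<in> Orb" "H \<noteq> M" for H
    proof (rule dvd_prime_power_neq_1[OF p])
      have "card (?orb H) dvd card M"
        using actM.orbit_stabilizer_theorem[OF OE[OF H(1)]] by (auto simp: order_def intro: dvdI[OF sym])
      then show "card (?orb H) dvd p ^ k" using oc by (metis dvd_mult)
      show "card (?orb H) \<noteq> 1"
      proof
        assume "card (?orb H) = 1"
        then obtain K where K: "?orb H = {K}" by (auto simp: card_1_singleton_iff)
        have fix_H: "\<phi> m H = H" if "m \<in> M" for m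
        proof -
          have "\<phi> m H \<in> ?orb H" using that by (auto simp: orbit_def)
          moreover have "H \<in> ?orb H" by (rule actM.orbit_refl[OF OE[OF H(1)]])
          ultimately show ?thesis using K by auto
        qed
        obtain g where g: "g \<in> carrier G" "H = \<phi> g M" using H(1) by (auto simp: Orb_def orbit_def)
        have "M \<subseteq> H"
        proof
          fix m assume m: "m \<in> M"
          let ?c = "inv g \<otimes> m \<otimes> g"
          have c: "?c \<in> carrier G" using g Mc[OF m] by simp
          have "\<phi> (g \<otimes> ?c) M = \<phi> (m \<otimes> g) M"
            using g Mc[OF m] by (simp add: m_assoc inv_mult_cancel_left)
          also have "\<dots> = \<phi> g M"
            using act.composition_rule[OF ME Mc[OF m] g(1)] fix_H[OF m] g(2) by simp
          finally have "\<phi> g (\<phi> ?c M) = \<phi> g M"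
            using act.composition_rule[OF ME g(1) c] by simp
          then have "\<phi> ?c M = M"
            using act.inj_prop[OF g(1)] act.element_image[OF c ME refl] ME by (auto dest: inj_onD)
          then have "?c \<in> M" using c 1 by (auto simp: N_def stabilizer_def)
          then show "m \<in> H" using mem[OF g(1) ME Mc[OF m]] g(2) by simp
        qed
        then have "H = M \<or> H = carrier G" using maxD OE[OF H(1)] by (simp add: E_def)
        then have H': "H = carrier G" using H(2) by simp
        have "x \<in> M" if x: "x \<in> carrier G" for x
        proof -
          have "g \<otimes> x \<otimes> inv g \<in> \<phi> g M"
            using x g(1) H' unfolding g(2)[symmetric] by simp
          then show ?thesis using mem[OF g(1) ME] x g(1)
            by (simp add: m_assoc inv_mult_cancel_left)
        qed
        then show False using M(2) Mc by blast
      qed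
    qed
    \<comment> \<open>The remaining orbits under \<open>M\<close> partition
      \<open>Orb - {M}\<close>, so \<open>p\<close> would divide both \<open>card Orb\<close> and
      \<open>card Orb - 1\<close>.\<close>
    let ?C = "?orb ` (Orb - {M})"
    have un: "\<Union>?C = Orb - {M}"
      using orbO notM actM.orbit_refl OE by blast
    have "p dvd card (\<Union>?C)"
    proof (rule dvd_partition)
      show "finite (\<Union>?C)" unfolding un using finO by simp
      show "\<forall>c\<in>?C. p dvd card c" using pdvd by auto
      show "\<forall>c1\<in>?C. \<forall>c2\<in>?C. c1 \<noteq> c2 \<longrightarrow> c1 \<inter> c2 = {}"
      proof (intro ballI impI)
        fix c1 c2 assume "c1 \<in> ?C" "c2 \<in> ?C" "c1 \<noteq> c2"
        moreover from this have "c1 \<in> orbits (G\<lparr>carrier := M\<rparr>) E \<phi>" "c2 \<in> orbits (G\<lparr>carrier := M\<rparr>) E \<phi>"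
          using OE by (auto simp: orbits_def)
        ultimately show "c1 \<inter> c2 = {}" using actM.disjoint_union by blast
      qed
    qed
    then have "p dvd card Orb - 1" using un finO MO by simp
    moreover have "card Orb > 0" using finO MO card_gt_0_iff by blast
    ultimately have "p dvd 1" using pO by (metis One_nat_def Suc_leI dvd_diffD1)
    then show ?thesis using p by (simp add: prime_nat_iff)
  qed
qed

text \<open>By Bezout, \<open>d\<close> is invertible modulo the order of \<open>b\<close>, so
  \<open>b\<close> is itself a power of \<open>b [^] d\<close>.\<close>

lemma (in group) mem_subgroup_of_coprime_pow:
  assumes H: "subgroup H G" and p: "Factorial_Ring.prime p"
    and b: "b \<in> carrier G" "ord b = p ^ j" and d: "coprime d p" "b [^] (d::nat) \<in> H"
  shows "b \<in> H"
proof -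
  have "d \<noteq> 0"
  proof
    assume "d = 0"
    then have "p = 1" using d(1) by simp
    then show False using p by simp
  qed
  moreover have "gcd d (p ^ j) = 1" using d(1) by simp
  ultimately obtain u v where uv: "d * u = p ^ j * v + 1" using bezout_nat by metis
  have "b [^] (d * u) = b [^] (p ^ j * v) \<otimes> b"
    using b(1) by (simp add: uv)
  also have "\<dots> = b"
    using b pow_eq_id[of b "p ^ j * v"] by simp
  finally have "b = (b [^] d) [^] u" using b(1) by (simp add: nat_pow_pow)
  moreover have "(b [^] d) [^] u \<in> H"
    by (induction u) (use H d(2) in \<open>auto simp: subgroup.one_closed subgroup.m_closed\<close>)
  ultimately show ?thesis by simp
qed

text \<open>The quotient by the normal subgroup \<open>M\<close> has only the two trivial subgroups,
  hence is cyclic of order \<open>p\<close>. The homomorphism is built from exponents of a fixed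
  \<open>b\<close> outside \<open>M\<close>: \<open>R_ex\<close> gives their existence,
  \<open>cong\<close> uniqueness modulo \<open>p\<close>, and \<open>R_mult\<close>
  additivity.\<close>

lemma (in group) maximal_subgroup_eq_kernel:
  assumes fin: "finite (carrier G)" and pg: "p_group p G" and max: "maximal_subgroup M G"
  obtains f where "f \<in> hom G (integer_mod_group p)" "M = {x \<in> carrier G. f x = 0}"
proof -
  have p: "Factorial_Ring.prime p" and ordp: "\<And>x. x \<in> carrier G \<Longrightarrow> \<exists>j. ord x = p ^ j"
    using pg by (auto simp: p_group_def)
  have p0: "p > 0" using p by (simp add: prime_gt_0_nat)
  have M: "subgroup M G" "M \<noteq> carrier G" and
    maxD: "\<And>H. \<lbrakk>subgroup H G; M \<subseteq> H\<rbrakk> \<Longrightarrow> H = M \<or> H = carrier G"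
    using max by (auto simp: maximal_subgroup_def)
  have Mc: "\<And>m. m \<in> M \<Longrightarrow> m \<in> carrier G" using M(1) subgroup.mem_carrier by metis
  interpret normal M G by (rule maximal_subgroup_normal[OF fin pg max])
  define R where "R b x k \<longleftrightarrow> x \<otimes> b [^] k \<in> M" for b x and k :: nat
  \<comment> \<open>For \<open>b \<notin> M\<close>, the residue of \<open>k\<close> with \<open>x b\<^sup>k \<in> M\<close> will be the value at \<open>x\<close>.\<close>
  have R_mult: "R b (x \<otimes> y) (k + l)"
    if "b \<in> carrier G" "x \<in> carrier G" "y \<in> carrier G" "R b x k" "R b y l" for b x y k l
  proof -
    let ?c = "b [^] k"
    have "(x \<otimes> ?c) \<otimes> (inv ?c \<otimes> (y \<otimes> b [^] l) \<otimes> ?c) \<in> M"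
      using that m_closed[OF _ inv_op_closed1] unfolding R_def by simp
    moreover have "(x \<otimes> ?c) \<otimes> (inv ?c \<otimes> (y \<otimes> b [^] l) \<otimes> ?c) = (x \<otimes> y) \<otimes> b [^] (l + k)"
      using that by (simp add: m_assoc inv_mult_cancel_left flip: nat_pow_mult)
    ultimately show ?thesis by (simp add: R_def add.commute)
  qed
  \<comment> \<open>The elements admitting an exponent form a subgroup that contains
    \<open>M\<close> and \<open>b\<close>, so by maximality it is everything. It is proved for any
    \<open>b\<close> outside \<open>M\<close> because \<open>bp\<close> applies it to a
    \<open>p\<close>-th power.\<close>
  have R_ex: "\<exists>k. R b x k" if b: "b \<in> carrier G" "b \<notin> M" and x: "x \<in> carrier G" for b x
  proof -
    let ?H = "{x \<in> carrier G. \<exists>k. R b x k}"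
    have "ord b > 0" using b(1) ordp p0 by (metis zero_less_power)
    have "subgroup ?H G"
    proof (rule subgroupI)
      show "?H \<subseteq> carrier G" by auto
      have "R b \<one> 0" by (simp add: R_def)
      then show "?H \<noteq> {}" by blast
    next
      fix x assume "x \<in> ?H"
      then obtain k where x: "x \<in> carrier G" and k: "x \<otimes> b [^] (k :: nat) \<in> M"
        by (auto simp: R_def)
      \<comment> \<open>A natural number standing in for the exponent \<open>-k\<close>.\<close>
      let ?l = "(ord b - 1) * k"
      have "?l + k = ord b * k" using \<open>ord b > 0\<close> by (simp add: algebra_simps)
      then have "b [^] ?l \<otimes> b [^] k = \<one>"
        using b(1) pow_eq_id[of b "ord b * k"] by (simp add: nat_pow_mult)
      then have l: "b [^] ?l = inv (b [^] k)" using b(1) by (simp add: inv_equality)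
      have "inv (inv x \<otimes> (x \<otimes> b [^] k) \<otimes> x) \<in> M" using k x by (intro m_inv_closed inv_op_closed1)
      also have "inv (inv x \<otimes> (x \<otimes> b [^] k) \<otimes> x) = inv x \<otimes> b [^] ?l"
        using x b(1) unfolding l by (simp add: inv_mult_group m_assoc inv_mult_cancel_left)
      finally show "inv x \<in> ?H" using x by (auto simp: R_def)
    next
      fix x y assume "x \<in> ?H" "y \<in> ?H"
      then show "x \<otimes> y \<in> ?H" using R_mult[OF b(1)] by blast
    qed
    moreover have "M \<subseteq> ?H"
    proof
      fix m assume "m \<in> M"
      then have "R b m 0" "m \<in> carrier G" using Mc by (auto simp: R_def)
      then show "m \<in> ?H" by blast
    qed
    moreover have "b \<in> ?H"
    proof -
      have "b \<otimes> b [^] (ord b - 1) = b [^] (1 + (ord b - 1))"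
        using b(1) by (subst nat_pow_mult[symmetric]) auto
      then have "R b b (ord b - 1)" using b(1) \<open>ord b > 0\<close> by (simp add: R_def)
      then show ?thesis using b(1) by blast
    qed
    ultimately have "?H = carrier G" using maxD[of ?H] b(2) by blast
    then show ?thesis using x by blast
  qed
  obtain b where b: "b \<in> carrier G" "b \<notin> M" using M(2) Mc by blast
  have coprimeD: False if "coprime d p" "b [^] (d::nat) \<in> M" for d
    using ordp[OF b(1)] mem_subgroup_of_coprime_pow[OF M(1) p b(1) _ that] b(2) by blast
  \<comment> \<open>If \<open>b [^] p\<close> were outside \<open>M\<close>, it could serve as the
    base in \<open>R_ex\<close>. This would put a power of \<open>b\<close> with exponent
    \<open>1 + p * k\<close>, coprime to \<open>p\<close>, into \<open>M\<close>.\<close>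
  have bp: "b [^] p \<in> M"
  proof (rule ccontr)
    assume "b [^] p \<notin> M"
    then obtain k :: nat where "b \<otimes> (b [^] p) [^] k \<in> M"
      using R_ex[of "b [^] p" b] b(1) by (auto simp: R_def)
    moreover have "b \<otimes> (b [^] p) [^] k = b [^] (1 + p * k)"
      using b(1) by (simp add: nat_pow_pow nat_pow_Suc2[symmetric] del: nat_pow_Suc)
    moreover have "coprime (1 + p * k) p"
      by (metis coprime_1_left coprime_add_one_left coprime_mult_left_iff add.commute dvd_triv_left coprime_commute) 
    ultimately show False using coprimeD[of "1 + p * k"] by metis
  qed
  have dvdD: "p dvd l - k" if "x \<in> carrier G" "R b x k" "R b x l" "k \<le> l" for x k l
  proof (rule ccontr)
    assume "\<not> p dvd l - k"
    then have "coprime (l - k) p" using p by (simp add: prime_imp_coprime coprime_commute)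
    moreover have "inv (x \<otimes> b [^] k) \<otimes> (x \<otimes> b [^] l) \<in> M"
      using that(2,3) m_closed[OF m_inv_closed] unfolding R_def by blast
    moreover have "b [^] l = b [^] k \<otimes> b [^] (l - k)"
      using b(1) that(4) by (simp add: nat_pow_mult)
    then have "inv (x \<otimes> b [^] k) \<otimes> (x \<otimes> b [^] l) = b [^] (l - k)"
      using that(1) b(1) by (simp add: inv_mult_group m_assoc inv_mult_cancel_left)
    ultimately show False using coprimeD by simp
  qed
  have cong: "k mod p = l mod p" if "x \<in> carrier G" "R b x k" "R b x l" for x k l
    using dvdD[OF that] dvdD[OF that(1,3,2)] mod_eq_dvd_iff_nat by (metis nat_le_linear)
  define f where "f x = int ((SOME k. R b x k) mod p)" for x
  have f_eq: "f x = int (k mod p)" if "x \<in> carrier G" "R b x k" for x k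
    unfolding f_def using cong[OF that(1) _ that(2)] someI[of "R b x", OF that(2)] by simp
  show thesis
  proof (rule that)
    show "f \<in> hom G (integer_mod_group p)"
    proof (rule homI)
      fix x assume x: "x \<in> carrier G"
      then show "f x \<in> carrier (integer_mod_group p)"
        using p0 by (simp add: f_def carrier_integer_mod_group)
    next
      fix x y assume xy: "x \<in> carrier G" "y \<in> carrier G"
      obtain k l where kl: "R b x k" "R b y l" using R_ex[OF b] xy by blast
      have "f (x \<otimes> y) = int ((k + l) mod p)" using f_eq R_mult[OF b(1) xy kl] xy by simp
      then show "f (x \<otimes> y) = f x \<otimes>\<^bsub>integer_mod_group p\<^esub> f y"
        using f_eq[OF xy(1) kl(1)] f_eq[OF xy(2) kl(2)] by (simp add: zmod_int mod_add_eq)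
    qed
    have "f x = 0 \<longleftrightarrow> x \<in> M" if x: "x \<in> carrier G" for x
    proof
      assume "x \<in> M"
      then have "R b x 0" using x by (simp add: R_def)
      then show "f x = 0" using f_eq[OF x] by simp
    next
      assume "f x = 0"
      obtain k where k: "R b x k" using R_ex[OF b x] by blast
      then have "p dvd k" using f_eq[OF x] \<open>f x = 0\<close> by (simp add: mod_eq_0_iff_dvd)
      then obtain j where "k = p * j" by auto
      then have "b [^] k = (b [^] p) [^] j" using b(1) by (simp add: nat_pow_pow)
      moreover have "(b [^] p) [^] j \<in> M"
        by (induction j) (use bp in auto)
      ultimately have "(x \<otimes> b [^] k) \<otimes> inv (b [^] k) \<in> M"
        using k m_closed[OF _ m_inv_closed] unfolding R_def by simp
      then show "x \<in> M" using x b(1) by (simp add: m_assoc)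
    qed
    then show "M = {x \<in> carrier G. f x = 0}" using Mc by blast
  qed
qed

subsection \<open>Separating families of homomorphisms to \<open>\<int>/p\<close>\<close>

text \<open>Values are the representatives from \<open>0\<close> to \<open>p - 1\<close>, so
  vanishing is equality with the integer \<open>0\<close>. Separation embeds \<open>G\<close> into a
  power of the field with \<open>p\<close> elements, which makes the \<open>f i\<close> linear
  functionals.\<close>

locale separating_homs = group G for G (structure) +
  fixes p :: nat and C :: "'i set" and f :: "'i \<Rightarrow> 'a \<Rightarrow> int"
  assumes finite_carrier: "finite (carrier G)"
    and prime: "Factorial_Ring.prime p"
    and finite_C: "finite C"
    and hom: "i \<in> C \<Longrightarrow> f i \<in> hom G (integer_mod_group p)"
    and separating: "x \<in> carrier G \<Longrightarrow> (\<And>i. i \<in> C \<Longrightarrow> f i x = 0) \<Longrightarrow> x = \<one>"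
begin

definition kern :: "'i set \<Rightarrow> 'a set"
  where "kern S = {x \<in> carrier G. \<forall>i\<in>S. f i x = 0}"

definition zeros :: "'a \<Rightarrow> 'i set"
  where "zeros x = {i \<in> C. f i x = 0}"

text \<open>Linear independence: a functional is a combination of the others exactly when it
  vanishes on their common kernel.\<close>

definition independent :: "'i set \<Rightarrow> bool"
  where "independent S \<longleftrightarrow> S \<subseteq> C \<and> (\<forall>i\<in>S. \<exists>x\<in>kern (S - {i}). f i x \<noteq> 0)"

lemma p_gt_1: "p > 1"
  using prime by (rule prime_gt_1_nat)

lemma hom_range: "\<lbrakk>i \<in> C; x \<in> carrier G\<rbrakk> \<Longrightarrow> 0 \<le> f i x \<and> f i x < int p"
  using hom_carrier[OF hom, of i] p_gt_1 by (auto simp: carrier_integer_mod_group image_subset_iff)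

lemma hom_eq_0_iff: "\<lbrakk>i \<in> C; x \<in> carrier G\<rbrakk> \<Longrightarrow> f i x = 0 \<longleftrightarrow> int p dvd f i x"
  using hom_range by (metis dvd_0_right zdvd_imp_le linorder_not_le order_le_less)

lemma hom_mult':
  "\<lbrakk>i \<in> C; x \<in> carrier G; y \<in> carrier G\<rbrakk> \<Longrightarrow> f i (x \<otimes> y) = (f i x + f i y) mod int p"
  using hom_mult[OF hom] by simp

lemma group_hom: "i \<in> C \<Longrightarrow> group_hom G (integer_mod_group p) (f i)"
  by (simp add: group_hom_def group_hom_axioms_def hom)

lemma hom_inv': "\<lbrakk>i \<in> C; x \<in> carrier G\<rbrakk> \<Longrightarrow> f i (inv x) = (- f i x) mod int p"
  using group_hom.hom_inv[OF group_hom] hom_in_carrier[OF hom] by simp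

lemma hom_pow': "\<lbrakk>i \<in> C; x \<in> carrier G\<rbrakk> \<Longrightarrow> f i (x [^] (k::nat)) = (int k * f i x) mod int p"
  using group_hom.hom_nat_pow[OF group_hom] by simp

lemma hom_one': "i \<in> C \<Longrightarrow> f i \<one> = 0"
  using group_hom.hom_one[OF group_hom] by simp

lemma hom_eq_iff:
  assumes "i \<in> C" "x \<in> carrier G" "y \<in> carrier G"
  shows "f i x = f i y \<longleftrightarrow> f i (inv x \<otimes> y) = 0"
proof -
  have "f i (inv x \<otimes> y) = (f i y - f i x) mod int p"
    using assms by (simp add: hom_mult' hom_inv' mod_simps)
  also have "\<dots> = 0 \<longleftrightarrow> f i y mod int p = f i x mod int p"
    by (simp add: mod_eq_dvd_iff mod_eq_0_iff_dvd)
  also have "\<dots> \<longleftrightarrow> f i y = f i x"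
    using assms hom_range by simp
  finally show ?thesis by auto
qed

lemma zeros_subset: "zeros x \<subseteq> C"
  by (auto simp: zeros_def)

lemma finite_zeros: "finite (zeros x)"
  using zeros_subset finite_C by (rule finite_subset)

lemma zeros_one: "zeros \<one> = C"
  using hom_one' by (auto simp: zeros_def)

lemma zeros_inv: "x \<in> carrier G \<Longrightarrow> zeros (inv x) = zeros x"
  using hom_eq_0_iff by (auto simp: zeros_def hom_inv' mod_eq_0_iff_dvd)

lemma kern_subset: "kern S \<subseteq> carrier G"
  by (auto simp: kern_def)

lemma finite_kern: "finite (kern S)"
  using kern_subset finite_carrier by (rule finite_subset)

lemma kern_subset_iff: "S \<subseteq> C \<Longrightarrow> x \<in> kern S \<longleftrightarrow> x \<in> carrier G \<and> S \<subseteq> zeros x"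
  by (auto simp: kern_def zeros_def)

lemma one_in_kern: "S \<subseteq> C \<Longrightarrow> \<one> \<in> kern S"
  using hom_one' by (auto simp: kern_def)

text \<open>On \<open>kern T\<close> the functional \<open>f i\<close> is nonzero, hence onto, and
  its \<open>p\<close> fibres are cosets of \<open>kern (insert i T)\<close>.\<close>

lemma card_kern_insert:
  assumes T: "T \<subseteq> C" and i: "i \<in> C" and x: "x \<in> kern T" "f i x \<noteq> 0"
  shows "card (kern T) = p * card (kern (insert i T))"
proof -
  have mult_closed: "y \<otimes> z \<in> kern T" and inv_closed: "inv y \<in> kern T"
    if "y \<in> kern T" "z \<in> kern T" for y z
    using that T hom_mult' hom_inv' by (auto simp: kern_def subset_eq)
  have carr: "y \<in> carrier G" if "y \<in> kern T" for y using that by (simp add: kern_def)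
  let ?fib = "\<lambda>v. {y \<in> kern T. f i y = v}"
  have fib: "card (?fib v) = card (kern (insert i T))" if v: "v \<in> {0..<int p}" for v
  proof -
    have xG: "x \<in> carrier G" using x carr by blast
    have "\<not> int p dvd f i x" using hom_eq_0_iff[OF i xG] x(2) by simp
    then have "coprime (f i x) (int p)"
      using prime by (simp add: prime_imp_coprime coprime_commute)
    then obtain u w where u: "u * f i x + w * int p = 1"
      using bezout_int by (metis coprime_imp_gcd_eq_1)
    \<comment> \<open>\<open>u\<close> inverts \<open>f i x\<close> modulo \<open>p\<close>, so the
      power of \<open>x\<close> with exponent \<open>u * v\<close> takes the value
      \<open>v\<close>.\<close>
    define r where "r = nat ((u * v) mod int p)"
    define y where "y = x [^] r"
    have r: "int r = (u * v) mod int p" using p_gt_1 by (simp add: r_def)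
    have "y \<in> carrier G" using xG by (simp add: y_def)
    have "y \<in> kern T"
      unfolding y_def by (induction r) (use mult_closed x(1) one_in_kern[OF T] in auto)
    have "f i y = (u * v * f i x) mod int p"
      using i xG by (simp add: y_def hom_pow' r mod_mult_left_eq)
    also have "u * v * f i x = (u * f i x + w * int p) * v + int p * (- w * v)"
      by (simp add: algebra_simps)
    also have "\<dots> mod int p = v"
      unfolding u mod_mult_self2 using v by simp
    finally have fy: "f i y = v" .
    have "bij_betw (\<lambda>z. y \<otimes> z) (kern (insert i T)) (?fib v)"
    proof (rule bij_betwI[where g = "\<lambda>z. inv y \<otimes> z"])
      show "(\<lambda>z. y \<otimes> z) \<in> kern (insert i T) \<rightarrow> ?fib v"
      proof
        fix z assume "z \<in> kern (insert i T)"
        then have "z \<in> kern T" "f i z = 0" "z \<in> carrier G" by (auto simp: kern_def)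
        then show "y \<otimes> z \<in> ?fib v"
          using mult_closed[OF \<open>y \<in> kern T\<close>] i \<open>y \<in> carrier G\<close> fy v by (simp add: hom_mult')
      qed
      show "(\<lambda>z. inv y \<otimes> z) \<in> ?fib v \<rightarrow> kern (insert i T)"
      proof
        fix z assume "z \<in> ?fib v"
        then have z: "z \<in> kern T" "f i z = f i y" using fy by auto
        then have "f i (inv y \<otimes> z) = 0"
          using hom_eq_iff[OF i \<open>y \<in> carrier G\<close> carr[OF z(1)]] by simp
        then show "inv y \<otimes> z \<in> kern (insert i T)"
          using mult_closed[OF inv_closed[OF \<open>y \<in> kern T\<close> z(1)] z(1)] by (simp add: kern_def)
      qed
    qed (use \<open>y \<in> carrier G\<close> in \<open>auto simp: kern_def inv_mult_cancel_left\<close>)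
    then show ?thesis by (rule bij_betw_same_card[symmetric])
  qed
  have "kern T = (\<Union>v\<in>{0..<int p}. ?fib v)"
    using hom_range[OF i carr] by auto
  then have "card (kern T) = (\<Sum>v\<in>{0..<int p}. card (?fib v))"
    using finite_kern by (subst card_UN_disjoint[symmetric]) auto
  also have "\<dots> = p * card (kern (insert i T))"
    using fib by simp
  finally show ?thesis .
qed

text \<open>Functionals are added one at a time. The witness for \<open>i\<close> given by
  independence still lies in the kernel of the part built so far, so each addition divides the size
  by \<open>p\<close>.\<close>

lemma card_kern_independent:
  assumes S: "independent S" and T: "T \<subseteq> S"
  shows "card (kern T) * p ^ card T = order G"
proof -
  have SC: "S \<subseteq> C" using S by (simp add: independent_def)
  then have "finite T" using T finite_subset[OF _ finite_C] by (meson subset_trans)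
  then show ?thesis using T
  proof (induction T)
    case empty
    then show ?case by (simp add: kern_def order_def)
  next
    case (insert i T)
    then obtain x where "x \<in> kern (S - {i})" "f i x \<noteq> 0"
      using S by (auto simp: independent_def)
    moreover have "kern (S - {i}) \<subseteq> kern T" using insert by (auto simp: kern_def)
    ultimately have "card (kern T) = p * card (kern (insert i T))"
      using insert.prems SC by (intro card_kern_insert) auto
    then show ?case using insert by (simp add: ac_simps)
  qed
qed

text \<open>Dropping \<open>i\<close> leaves a nontrivial element in the common kernel, and only
  \<open>f i\<close> can detect it.\<close>

lemma independent_minimal:
  assumes S: "S \<subseteq> C" "kern S = {\<one>}" and min: "\<And>T. \<lbrakk>T \<subset> S; kern T = {\<one>}\<rbrakk> \<Longrightarrow> False"
  shows "independent S"
  unfolding independent_def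
proof (intro conjI ballI S)
  fix i assume i: "i \<in> S"
  then have "kern (S - {i}) \<noteq> {\<one>}" using min by blast
  moreover have "\<one> \<in> kern (S - {i})" using S by (intro one_in_kern) auto
  ultimately obtain x where x: "x \<in> kern (S - {i})" "x \<noteq> \<one>" by blast
  then have "x \<notin> kern S" using S by simp
  then have "f i x \<noteq> 0" using x by (auto simp: kern_def)
  then show "\<exists>x\<in>kern (S - {i}). f i x \<noteq> 0" using x by blast
qed

text \<open>The functionals in \<open>S\<close> serve as coordinates: a trivial kernel gives
  injectivity, and comparing cardinalities gives surjectivity.\<close>

lemma iso_direct_power_cyclic:
  assumes S: "independent S" "kern S = {\<one>}"
  shows "G \<cong> direct_power_cyclic p (card S)"
proof -
  let ?P = "direct_power_cyclic p (card S)"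
  have SC: "S \<subseteq> C" using S by (simp add: independent_def)
  have carr: "carrier ?P = {..<card S} \<rightarrow>\<^sub>E {0..<int p}"
    using p_gt_1 by (simp add: direct_power_cyclic_def carrier_integer_mod_group)
  obtain e where e: "bij_betw e {..<card S} S"
    using bij_betw_from_nat_into_finite finite_subset[OF SC finite_C] by blast
  then have eC: "e k \<in> C" if "k < card S" for k
    using that SC bij_betwE by fastforce
  define \<Phi> where "\<Phi> x = (\<lambda>k\<in>{..<card S}. f (e k) x)" for x
  have into: "\<Phi> x \<in> carrier ?P" if "x \<in> carrier G" for x
    using hom_range eC that unfolding carr \<Phi>_def by auto
  have "\<Phi> \<in> hom G ?P"
    using into by (intro homI) (auto simp: \<Phi>_def direct_power_cyclic_def hom_mult' eC)
  moreover have inj: "inj_on \<Phi> (carrier G)"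
  proof (rule inj_onI)
    fix x y assume x: "x \<in> carrier G" and y: "y \<in> carrier G" and eq: "\<Phi> x = \<Phi> y"
    have "f i (inv x \<otimes> y) = 0" if "i \<in> S" for i
    proof -
      have "i \<in> e ` {..<card S}" using bij_betw_imp_surj_on[OF e] that by simp
      then obtain k where "k < card S" "i = e k" by blast
      then have "f i x = f i y" using fun_cong[OF eq, of k] by (simp add: \<Phi>_def)
      then show ?thesis using hom_eq_iff SC that x y by auto
    qed
    then have "inv x \<otimes> y \<in> kern S" using x y by (simp add: kern_def)
    then have "inv x \<otimes> y = \<one>" using S(2) by simp
    then show "x = y" using x y by (metis inv_closed inv_equality inv_inv)
  qed
  moreover have "\<Phi> ` carrier G = carrier ?P"
  proof (rule card_subset_eq)
    show "finite (carrier ?P)" unfolding carr by (intro finite_PiE) auto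
    show "\<Phi> ` carrier G \<subseteq> carrier ?P" using into by auto
    have "card (\<Phi> ` carrier G) = order G" using inj by (simp add: card_image order_def)
    also have "\<dots> = p ^ card S" using card_kern_independent[OF S(1) order_refl] S(2) by simp
    also have "\<dots> = card (carrier ?P)" unfolding carr by (simp add: card_PiE)
    finally show "card (\<Phi> ` carrier G) = card (carrier ?P)" .
  qed
  ultimately show ?thesis by (auto simp: is_iso_def iso_def bij_betw_def)
qed

text \<open>Double counting of pairs of an element and a \<open>k\<close>-set of functionals
  vanishing at it.\<close>

lemma sum_card_zeros_choose:
  "(\<Sum>x\<in>carrier G. card (zeros x) choose k) = (\<Sum>S\<in>{S. S \<subseteq> C \<and> card S = k}. card (kern S))"
proof -
  let ?P = "{S. S \<subseteq> C \<and> card S = k}"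
  have finP: "finite ?P" using finite_C by simp
  have "(\<Sum>x\<in>carrier G. card (zeros x) choose k)
      = (\<Sum>x\<in>carrier G. card {S \<in> ?P. x \<in> kern S})"
  proof (rule sum.cong[OF refl])
    fix x assume x: "x \<in> carrier G"
    have "card (zeros x) choose k = card {S. S \<subseteq> zeros x \<and> card S = k}"
      using n_subsets[OF finite_zeros] by simp
    also have "{S. S \<subseteq> zeros x \<and> card S = k} = {S \<in> ?P. x \<in> kern S}"
      using x zeros_subset kern_subset_iff by blast
    finally show "card (zeros x) choose k = card {S \<in> ?P. x \<in> kern S}" .
  qed
  also have "\<dots> = (\<Sum>S\<in>?P. card {x \<in> carrier G. x \<in> kern S})"
    by (rule sum_multicount_gen[OF finite_carrier finP]) simp
  also have "\<dots> = (\<Sum>S\<in>?P. card (kern S))"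
    by (intro sum.cong refl arg_cong[where f = card]) (use kern_subset in blast)
  finally show ?thesis .
qed

end

subsection \<open>Irredundant covering families\<close>

locale irredundant_covering_homs = separating_homs +
  assumes covering: "x \<in> carrier G \<Longrightarrow> zeros x \<noteq> {}"
    and irredundant: "i \<in> C \<Longrightarrow> \<exists>x\<in>carrier G. zeros x = {i}"
begin

lemma card_zeros_pos: "x \<in> carrier G \<Longrightarrow> card (zeros x) > 0"
  using covering finite_zeros by (simp add: card_gt_0_iff)

text \<open>A coset \<open>a\<langle>x\<rangle>\<close> avoiding the kernels that contain \<open>x\<close> meets every other kernel at most once.\<close>

lemma card_zeros_le:
  assumes x: "x \<in> carrier G" "x \<noteq> \<one>"
  shows "card (zeros x) + p \<le> card C"
proof -
  have "zeros x \<noteq> C" using x separating by (auto simp: zeros_def)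
  then obtain i where i: "i \<in> C" "i \<notin> zeros x" using zeros_subset by blast
  \<comment> \<open>\<open>a\<close> lies in the kernel of \<open>f i\<close> alone, and
    \<open>x\<close> does not lie in it. Hence no kernel containing \<open>x\<close> contains any
    \<open>a \<otimes> x [^] k\<close>. The function \<open>g\<close> below picks a kernel covering
    each such product.\<close>
  obtain a where a: "a \<in> carrier G" "zeros a = {i}" using irredundant i by blast
  have "\<exists>j. j \<in> C \<and> f j (a \<otimes> x [^] k) = 0" for k :: nat
    using covering[of "a \<otimes> x [^] k"] a x by (auto simp: zeros_def)
  then obtain g where g: "\<And>k::nat. g k \<in> C" "\<And>k. f (g k) (a \<otimes> x [^] k) = 0" by metis
  have gf: "int p dvd f (g k) a + int k * f (g k) x" for k
    using g[of k] a x by (simp add: hom_mult' hom_pow' mod_add_right_eq mod_eq_0_iff_dvd)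
  have gx: "g k \<notin> zeros x" for k
  proof
    assume z: "g k \<in> zeros x"
    then have "f (g k) a = 0" using gf[of k] hom_eq_0_iff[OF g(1) a(1)] by (simp add: zeros_def)
    then have "g k = i" using a(2) g(1)[of k] by (auto simp: zeros_def)
    then show False using z i by simp
  qed
  \<comment> \<open>Two products in one kernel give \<open>(k - l) * f (g k) x\<close> divisible by
    \<open>p\<close>, although \<open>f (g k) x\<close> is not.\<close>
  have "inj_on g {..<p}"
  proof (rule inj_onI)
    fix k l assume kl: "k \<in> {..<p}" "l \<in> {..<p}" "g k = g l"
    have "int p dvd (f (g k) a + int k * f (g k) x) - (f (g k) a + int l * f (g k) x)"
      using gf[of k] gf[of l] kl(3) by (simp only: dvd_diff)
    then have "int p dvd (int k - int l) * f (g k) x" by (simp add: algebra_simps)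
    moreover have "\<not> int p dvd f (g k) x"
      using gx[of k] g(1) hom_eq_0_iff[OF g(1) x(1)] by (simp add: zeros_def)
    ultimately have "int p dvd int k - int l" using prime by (simp add: prime_dvd_mult_iff)
    then have "int k mod int p = int l mod int p" by (simp add: mod_eq_dvd_iff)
    then show "k = l" using kl by simp
  qed
  then have "p \<le> card (C - zeros x)"
    using g(1) gx finite_C by (intro card_inj_on_le[of g "{..<p}", simplified]) auto
  also have "\<dots> = card C - card (zeros x)" using zeros_subset finite_zeros by (rule card_Diff_subset[rotated])
  finally show ?thesis using p_gt_1 by linarith
qed

text \<open>A nontrivial element of \<open>kern S\<close> would be a zero of more functionals than
  \<open>card_zeros_le\<close> allows.\<close>

lemma kern_eq_one:
  assumes "S \<subseteq> C" "card C < card S + p"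
  shows "kern S = {\<one>}"
proof -
  have "x = \<one>" if "x \<in> kern S" for x
  proof (rule ccontr)
    assume "x \<noteq> \<one>"
    then have "card (zeros x) + p \<le> card C" using that card_zeros_le by (simp add: kern_def)
    moreover have "card S \<le> card (zeros x)"
      using that assms(1) finite_zeros by (intro card_mono) (auto simp: kern_subset_iff)
    ultimately show False using assms(2) by linarith
  qed
  then show ?thesis using one_in_kern[OF assms(1)] by blast
qed

lemma kern_not_subset_kern:
  assumes "i \<in> C" "j \<in> C" "i \<noteq> j"
  shows "\<exists>x\<in>kern {j}. f i x \<noteq> 0"
proof -
  obtain x where x: "x \<in> carrier G" "zeros x = {j}" using irredundant assms by blast
  then have "j \<in> zeros x" "i \<notin> zeros x" using assms by auto
  then show ?thesis using x(1) assms by (auto simp: zeros_def kern_def)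
qed

text \<open>Any two functionals are independent, because each kernel has a point outside all the
  others.\<close>

lemma card_kern_pair:
  assumes "i \<in> C" "j \<in> C" "i \<noteq> j"
  shows "card (kern {i}) * p = order G" "card (kern {i, j}) * p ^ 2 = order G"
proof -
  have ind: "independent {i, j}"
    using assms kern_not_subset_kern[of i j] kern_not_subset_kern[of j i]
    by (auto simp: independent_def insert_Diff_if)
  show "card (kern {i}) * p = order G" using card_kern_independent[OF ind, of "{i}"] by simp
  show "card (kern {i, j}) * p ^ 2 = order G"
    using card_kern_independent[OF ind order_refl] assms by (simp add: power2_eq_square)
qed

section \<open>Moments of the number of vanishing functionals\<close>

lemma sum_card_zeros:
  assumes "card C > 1"
  shows "(\<Sum>x\<in>carrier G. card (zeros x)) * p = card C * order G"
proof -
  have "card (kern S) * p = order G" if S: "S \<subseteq> C" "card S = 1" for S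
  proof -
    obtain i where i: "S = {i}" using S(2) card_1_singletonE by blast
    have "C \<noteq> {i}" using assms by auto
    then obtain j where "j \<in> C" "i \<noteq> j" using S i by blast
    then show ?thesis using card_kern_pair(1) S i by simp
  qed
  then have "(\<Sum>S\<in>{S. S \<subseteq> C \<and> card S = 1}. card (kern S)) * p = (card C choose 1) * order G"
    using n_subsets[OF finite_C, of 1] by (simp add: sum_distrib_right)
  then show ?thesis using sum_card_zeros_choose[of 1] by simp
qed

lemma sum_card_zeros_choose_2:
  "(\<Sum>x\<in>carrier G. card (zeros x) choose 2) * p ^ 2 = (card C choose 2) * order G"
proof -
  have "card (kern S) * p ^ 2 = order G" if "S \<subseteq> C" "card S = 2" for S
    using that card_kern_pair(2) by (auto simp: card_2_iff)
  then have "(\<Sum>S\<in>{S. S \<subseteq> C \<and> card S = 2}. card (kern S)) * p ^ 2 = (card C choose 2) * order G"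
    using n_subsets[OF finite_C, of 2] by (simp add: sum_distrib_right)
  then show ?thesis using sum_card_zeros_choose[of 2] by simp
qed

lemma nontrivial:
  assumes "card C > 1"
  obtains x where "x \<in> carrier G" "x \<noteq> \<one>"
proof -
  obtain i where i: "i \<in> C" using assms by fastforce
  then obtain x where "x \<in> carrier G" "zeros x = {i}" using irredundant by blast
  moreover have "C \<noteq> {i}" using assms by auto
  ultimately show ?thesis using that zeros_one by metis
qed

lemma prime_less:
  assumes "card C > 1"
  shows "p < card C"
proof -
  obtain x where x: "x \<in> carrier G" "x \<noteq> \<one>" using nontrivial[OF assms] .
  have "card (zeros x) > 0" by (rule card_zeros_pos[OF x(1)])
  then show ?thesis using card_zeros_le[OF x] by linarith
qed

section \<open>The case p = 2\<close>

lemma iso_direct_power_cyclic_2: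
  assumes p: "p = 2" and C: "card C = 7"
  shows "G \<cong> direct_power_cyclic 2 6"
proof -
  obtain i where i: "i \<in> C" using C by fastforce
  define S where "S = C - {i}"
  have S: "S \<subseteq> C" "card S = 6" using i C finite_C by (auto simp: S_def)
  have "kern S = {\<one>}" using S by (intro kern_eq_one) (simp_all add: p C)
  moreover have "independent S"
    unfolding independent_def
  proof (intro conjI ballI S)
    fix j assume "j \<in> S"
    then have j: "j \<in> C" "j \<noteq> i" by (auto simp: S_def)
    obtain x where x: "x \<in> carrier G" "zeros x = {i}" using irredundant[OF i] by blast
    obtain y where y: "y \<in> carrier G" "zeros y = {j}" using irredundant[OF j(1)] by blast
    have val: "f k z = (if k \<in> zeros z then 0 else 1)" if "k \<in> C" "z \<in> carrier G" for k z
      using hom_range[OF that] that by (auto simp: zeros_def p)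
    \<comment> \<open>Modulo 2, \<open>f k x\<close> is \<open>0\<close> only at
      \<open>k = i\<close> and \<open>f k y\<close> only at \<open>k = j\<close>, so elsewhere the
      sum is \<open>1 + 1 = 0\<close>. Within \<open>S\<close>, which omits \<open>i\<close>, only
      \<open>f j\<close> detects the product.\<close>
    have "f k (x \<otimes> y) = (if k = i \<or> k = j then 1 else 0)" if "k \<in> C" for k
      using that x y j val[of k x] val[of k y] by (auto simp: hom_mult' p)
    then show "\<exists>x\<in>kern (S - {j}). f j x \<noteq> 0"
      using x y j by (intro bexI[of _ "x \<otimes> y"]) (auto simp: kern_def S_def)
  qed
  ultimately show ?thesis using iso_direct_power_cyclic[of S] S(2) p by simp
qed

text \<open>The second moment comes from \<open>n^2 = 2 * (n choose 2) + n\<close>. Powers of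
  \<open>p\<close> are multiplied out to avoid division, and integers allow signed polynomials in
  \<open>n\<close>.\<close>

lemma sums_card_zeros:
  fixes N :: int
  assumes C: "card C = 7"
  defines "N \<equiv> int (order G)"
  shows "int p * (\<Sum>x\<in>carrier G. int (card (zeros x))) = 7 * N"
    and "int p ^ 2 * (\<Sum>x\<in>carrier G. int (card (zeros x)) ^ 2) = (42 + 7 * int p) * N"
proof -
  let ?n = "\<lambda>x. int (card (zeros x))"
  have "int ((\<Sum>x\<in>carrier G. card (zeros x)) * p) = 7 * N"
    using sum_card_zeros C by (simp add: N_def)
  then show s1: "int p * (\<Sum>x\<in>carrier G. ?n x) = 7 * N" by (simp add: mult.commute)
  have ch: "2 * int (m choose 2) = int m ^ 2 - int m" for m
  proof -
    have "even (m * (m - 1))" by (cases m) auto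
    then have "2 * (m choose 2) = m * (m - 1)" by (simp add: choose_two)
    then have "2 * int (m choose 2) = int (m * (m - 1))" by presburger
    then show ?thesis by (cases m) (simp_all add: power2_eq_square algebra_simps)
  qed
  have "(7 choose 2 :: nat) = 21" by (simp add: choose_two)
  then have "int ((\<Sum>x\<in>carrier G. card (zeros x) choose 2) * p ^ 2) = 21 * N"
    using sum_card_zeros_choose_2 C by (simp add: N_def)
  then have "int p ^ 2 * (\<Sum>x\<in>carrier G. 2 * int (card (zeros x) choose 2)) = 42 * N"
    by (simp add: mult.commute flip: sum_distrib_left)
  then have "int p ^ 2 * (\<Sum>x\<in>carrier G. ?n x ^ 2) - int p * (int p * (\<Sum>x\<in>carrier G. ?n x)) = 42 * N"
    unfolding ch by (simp add: sum_subtractf algebra_simps power2_eq_square)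
  then show "int p ^ 2 * (\<Sum>x\<in>carrier G. ?n x ^ 2) = (42 + 7 * int p) * N"
    unfolding s1 by (simp add: algebra_simps)
qed

text \<open>The identity is a zero of every functional and escapes \<open>card_zeros_le\<close>, so
  its term is split off.\<close>

lemma sum_eq_insert_one:
  fixes h :: "nat \<Rightarrow> int"
  shows "(\<Sum>x\<in>carrier G. h (card (zeros x))) =
    h (card C) + (\<Sum>x\<in>carrier G - {\<one>}. h (card (zeros x)))"
  using finite_carrier by (subst sum.remove[of _ \<one>]) (simp_all add: zeros_one)

section \<open>Exclusion of p = 5\<close>

lemma prime_neq_5:
  assumes C: "card C = 7"
  shows "p \<noteq> 5"
proof
  assume p: "p = 5"
  let ?n = "\<lambda>x. int (card (zeros x))"
  have "(?n x - 1) * (?n x - 2) = 0" if "x \<in> carrier G - {\<one>}" for x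
  proof -
    have "card (zeros x) = 1 \<or> card (zeros x) = 2"
      using that card_zeros_pos[of x] card_zeros_le[of x] by (simp add: p C) linarith
    then show ?thesis by auto
  qed
  then have "(\<Sum>x\<in>carrier G - {\<one>}. (?n x - 1) * (?n x - 2)) = 0"
    by (rule sum.neutral[OF ballI])
  then have "(\<Sum>x\<in>carrier G. (?n x - 1) * (?n x - 2)) = 30"
    using sum_eq_insert_one[of "\<lambda>m. (int m - 1) * (int m - 2)"] by (simp add: C)
  moreover have "(\<Sum>x\<in>carrier G. (?n x - 1) * (?n x - 2))
      = (\<Sum>x\<in>carrier G. ?n x ^ 2 - 3 * ?n x + 2)"
    by (intro sum.cong refl) (simp add: algebra_simps power2_eq_square)
  then have "(\<Sum>x\<in>carrier G. (?n x - 1) * (?n x - 2))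
      = (\<Sum>x\<in>carrier G. ?n x ^ 2) - 3 * (\<Sum>x\<in>carrier G. ?n x) + 2 * int (order G)"
    by (simp add: sum.distrib sum_subtractf sum_distrib_left order_def)
  \<comment> \<open>Multiplying by 25 gives \<open>(77 - 105 + 50) * N = 750\<close> for the order
    \<open>N\<close>, and 11 does not divide 375.\<close>
  ultimately have "11 * int (order G) = 375"
    using sums_card_zeros[OF C] by (simp add: p)
  then show False by presburger
qed

section \<open>The case p = 3\<close>

text \<open>The product \<open>(n - 2) * (n - 3)\<close> is nonnegative at integers. Each kernel has
  at least two points lying in no other kernel, an element and its inverse, giving 14 terms equal to
  2. With 20 from the identity the sum is at least 48, while the moments make it
  \<open>4 * N / 3\<close>.\<close>

lemma order_ge_36:
  assumes p: "p = 3" and C: "card C = 7"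
  shows "36 \<le> order G"
proof -
  let ?n = "\<lambda>x. int (card (zeros x))"
  let ?h = "\<lambda>x. (?n x - 2) * (?n x - 3)"
  define A where "A i = {x \<in> carrier G. zeros x = {i}}" for i
  have A: "card (A i) \<ge> 2" if i: "i \<in> C" for i
  proof -
    obtain x where x: "x \<in> carrier G" "zeros x = {i}" using irredundant[OF i] by blast
    have "C \<noteq> {i}" using C by auto
    then obtain j where j: "j \<in> C" "j \<noteq> i" using i by blast
    have "inv x \<noteq> x"
    proof
      assume "inv x = x"
      then have "f j x = (- f j x) mod 3" using hom_inv'[OF j(1) x(1)] by (simp add: p)
      moreover have "0 \<le> f j x" "f j x < 3" using hom_range[OF j(1) x(1)] by (simp_all add: p)
      ultimately have "f j x = 0" by presburger
      then show False using j x(2) by (auto simp: zeros_def)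
    qed
    then have "card {x, inv x} = 2" by simp
    moreover have "card {x, inv x} \<le> card (A i)"
      using x finite_carrier by (intro card_mono) (auto simp: A_def zeros_inv)
    ultimately show ?thesis by simp
  qed
  have "14 \<le> (\<Sum>i\<in>C. card (A i))"
    using sum_mono[of C "\<lambda>_. 2" "\<lambda>i. card (A i)"] A C by simp
  also have "\<dots> = card (\<Union>i\<in>C. A i)"
    using finite_C finite_carrier by (intro card_UN_disjoint[symmetric]) (auto simp: A_def)
  finally have U: "14 \<le> card (\<Union>i\<in>C. A i)" .
  have "28 \<le> (\<Sum>x\<in>(\<Union>i\<in>C. A i). ?h x)"
  proof -
    have "(\<Sum>x\<in>(\<Union>i\<in>C. A i). ?h x) = (\<Sum>x\<in>(\<Union>i\<in>C. A i). 2)"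
      by (intro sum.cong refl) (auto simp: A_def)
    then show ?thesis using U by simp
  qed
  also have "\<dots> \<le> (\<Sum>x\<in>carrier G - {\<one>}. ?h x)"
  proof (rule sum_mono2)
    have "C \<noteq> {i}" for i using C by auto
    then show "(\<Union>i\<in>C. A i) \<subseteq> carrier G - {\<one>}" using zeros_one by (auto simp: A_def)
    have "0 \<le> (m - 2) * (m - 3)" for m :: int
      by (cases "m \<le> 2") (simp_all add: mult_nonneg_nonneg mult_nonpos_nonpos)
    then show "0 \<le> ?h x" for x .
  qed (use finite_carrier in auto)
  finally have "48 \<le> (\<Sum>x\<in>carrier G. ?h x)"
    using sum_eq_insert_one[of "\<lambda>m. (int m - 2) * (int m - 3)"] by (simp add: C)
  moreover have "(\<Sum>x\<in>carrier G. ?h x) = (\<Sum>x\<in>carrier G. ?n x ^ 2 - 5 * ?n x + 6)"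
    by (intro sum.cong refl) (simp add: algebra_simps power2_eq_square)
  then have "(\<Sum>x\<in>carrier G. ?h x)
      = (\<Sum>x\<in>carrier G. ?n x ^ 2) - 5 * (\<Sum>x\<in>carrier G. ?n x) + 6 * int (order G)"
    by (simp add: sum.distrib sum_subtractf sum_distrib_left order_def)
  ultimately show ?thesis
    using sums_card_zeros[OF C] by (simp add: p)
qed

text \<open>Under the hypothesis the common kernel of any \<open>k \<le> 5\<close> functionals has
  \<open>3 ^ (5 - k)\<close> elements. This fixes the binomial sums of \<open>n\<close> up to
  \<open>k = 5\<close>, and an alternating combination of them is contradictory.\<close>

lemma not_all_5_subsets_independent:
  assumes p: "p = 3" and C: "card C = 7"
    and ind: "\<And>S. \<lbrakk>S \<subseteq> C; card S = 5\<rbrakk> \<Longrightarrow> independent S \<and> kern S = {\<one>}"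
  shows False
proof -
  have card_kern: "card (kern U) = 3 ^ (5 - card U)" if U: "U \<subseteq> C" "card U \<le> 5" for U
  proof -
    obtain T where T: "U \<subseteq> T" "T \<subseteq> C" "card T = 5"
      using exists_subset_between[of U 5 C] U C finite_C by auto
    then have i: "independent T" and k: "kern T = {\<one>}" using ind by auto
    have "card (kern U) * 3 ^ card U = 3 ^ 5"
      using card_kern_independent[OF i T(1)] card_kern_independent[OF i order_refl] k T(3) p by simp
    also have "\<dots> = 3 ^ (5 - card U) * 3 ^ card U" using U(2) by (simp flip: power_add)
    finally show ?thesis by simp
  qed
  have N: "order G = 243"
    using card_kern[of "{}"] by (simp add: kern_def order_def)
  have s: "(\<Sum>x\<in>carrier G. int (card (zeros x) choose k)) = int (7 choose k) * 3 ^ (5 - k)"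
    if "k \<le> 5" for k
  proof -
    have "(\<Sum>x\<in>carrier G. card (zeros x) choose k) = (7 choose k) * 3 ^ (5 - k)"
      unfolding sum_card_zeros_choose using card_kern that n_subsets[OF finite_C, of k] C by simp
    then show ?thesis by (metis of_nat_mult of_nat_numeral of_nat_power of_nat_sum)
  qed
  \<comment> \<open>For \<open>m > 0\<close> this is \<open>m - 1 choose 4\<close>.\<close>
  let ?h = "\<lambda>m. int (m choose 4) - int (m choose 3) + int (m choose 2) - int (m choose 1) + int (m choose 0)"
  have "?h (card (zeros x)) = 0" if "x \<in> carrier G - {\<one>}" for x
  proof -
    have "card (zeros x) \<in> {1, 2, 3, 4}"
      using that card_zeros_pos[of x] card_zeros_le[of x] by (simp add: p C) linarith
    then show ?thesis by (auto simp: numeral_eq_Suc)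
  qed
  then have "(\<Sum>x\<in>carrier G - {\<one>}. ?h (card (zeros x))) = 0"
    by (rule sum.neutral[OF ballI])
  then have "(\<Sum>x\<in>carrier G. ?h (card (zeros x))) = ?h 7"
    using sum_eq_insert_one[of ?h] C by simp
  moreover have "(\<Sum>x\<in>carrier G. ?h (card (zeros x))) = int (7 choose 4) * 3 ^ (5 - 4)
      - int (7 choose 3) * 3 ^ (5 - 3) + int (7 choose 2) * 3 ^ (5 - 2) - int (7 choose 1) * 3 ^ (5 - 1)
      + int (7 choose 0) * 3 ^ (5 - 0)"
    unfolding sum.distrib sum_subtractf by (subst (1 2 3 4 5) s) simp_all
  \<comment> \<open>The identity contributes \<open>6 choose 4\<close>, which is 15, whereas the
    binomial sums combine to 33.\<close>
  ultimately show False by (simp add: numeral_eq_Suc)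
qed

lemma iso_direct_power_cyclic_3:
  assumes p: "p = 3" and C: "card C = 7"
  shows "G \<cong> direct_power_cyclic 3 4"
proof -
  have "kern C = {\<one>}" by (rule kern_eq_one) (simp_all add: p)
  then obtain S where S: "S \<subseteq> C" "kern S = {\<one>}"
    and min: "\<And>T. \<lbrakk>T \<subseteq> C; kern T = {\<one>}\<rbrakk> \<Longrightarrow> card S \<le> card T"
    using ex_has_least_nat[of "\<lambda>S. S \<subseteq> C \<and> kern S = {\<one>}" C card] by auto
  \<comment> \<open>Stated for every separating set of the least size, so that it reaches all
    5-subsets if that size is 5.\<close>
  have ind: "independent T" if T: "T \<subseteq> C" "kern T = {\<one>}" "card T = card S" for T
  proof (rule independent_minimal[OF T(1,2)])
    fix U assume U: "U \<subset> T" "kern U = {\<one>}"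
    then have "card U < card T" using T(1) finite_C by (meson finite_subset psubset_card_mono)
    then show False using min[of U] U T by auto
  qed
  have five: "kern T = {\<one>}" if "T \<subseteq> C" "card T = 5" for T
    using that by (intro kern_eq_one) (simp_all add: p C)
  obtain T where T: "T \<subseteq> C" "card T = 5"
    using obtain_subset_with_card_n[of 5 C] C by auto
  then have "card S \<le> 5" using min[OF T(1) five[OF T]] by simp
  moreover have "card S \<noteq> 5"
    using not_all_5_subsets_independent[OF p C] ind five by metis
  \<comment> \<open>The order is \<open>3 ^ card S\<close> and exceeds 27.\<close>
  moreover have "3 ^ 3 < order G" using order_ge_36[OF p C] by simp
  then have "(3::nat) ^ 3 < 3 ^ card S"
    using card_kern_independent[OF ind[OF S refl] order_refl] S(2) p by simp
  then have "3 < card S" by (subst (asm) power_strict_increasing_iff) simp_all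
  ultimately have "card S = 4" by simp
  then show ?thesis using iso_direct_power_cyclic[OF ind[OF S refl] S(2)] p by simp
qed

end

subsection \<open>The classification\<close>

lemma p_group_direct_power_cyclic:
  assumes "Factorial_Ring.prime p"
  shows "p_group p (direct_power_cyclic p m)"
proof -
  let ?P = "direct_power_cyclic p m"
  have P: "group ?P" by (simp add: direct_power_cyclic_def)
  then interpret P: group ?P .
  have "\<exists>k. P.ord x = p ^ k" if x: "x \<in> carrier ?P" for x
  proof -
    have pow: "x [^]\<^bsub>?P\<^esub> k = (\<lambda>i\<in>{..<m}. (int k * x i) mod int p)" for k :: nat
      by (induction k)
        (auto simp: direct_power_cyclic_def fun_eq_iff algebra_simps mod_simps)
    have "x [^]\<^bsub>?P\<^esub> p = \<one>\<^bsub>?P\<^esub>"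
      unfolding pow by (auto simp: direct_power_cyclic_def)
    then have "P.ord x dvd p" using P.pow_eq_id[OF x] by blast
    then have "P.ord x = 1 \<or> P.ord x = p" using assms prime_nat_iff by blast
    then show ?thesis by (metis power_0 power_one_right)
  qed
  then show ?thesis using assms P by (simp add: p_group_def)
qed

lemma p_group_iso:
  assumes "p_group p H" "group G" "G \<cong> H"
  shows "p_group p G"
proof -
  obtain h where h: "h \<in> iso G H" using assms(3) by (auto simp: is_iso_def)
  interpret G: group G by fact
  interpret H: group H using assms(1) by (simp add: p_group_def)
  interpret h: group_hom G H h using h by unfold_locales (simp add: iso_def)
  have inj: "inj_on h (carrier G)" using h by (simp add: iso_def bij_betw_def)
  have "G.ord x = H.ord (h x)" if x: "x \<in> carrier G" for x
  proof -
    have "x [^]\<^bsub>G\<^esub> n = \<one>\<^bsub>G\<^esub> \<longleftrightarrow> H.ord (h x) dvd n" for n :: nat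
      using inj x h.hom_nat_pow[OF x, of n] H.pow_eq_id[of "h x" n] h.hom_one
      by (metis G.nat_pow_closed G.one_closed h.hom_closed inj_on_eq_iff)
    then show ?thesis using G.ord_unique[OF x] by blast
  qed
  then show ?thesis
    using assms(1,2) by (auto simp: p_group_def)
qed

lemma p_group_C_7:
  assumes C7: "C_group 7 G" and pg: "p_group p G"
  shows "G \<cong> direct_power_cyclic 2 6 \<or> G \<cong> direct_power_cyclic 3 4"
proof -
  interpret G: group G using C7 by (simp add: C_group_def)
  obtain C where C: "C_cover 7 G C" using C7 by (auto simp: C_group_def)
  have irr: "irredundant_cover G C" and max: "\<And>M. M \<in> C \<Longrightarrow> maximal_subgroup M G"
    and core: "normal_core G (\<Inter>C) = {\<one>\<^bsub>G\<^esub>}" and finC: "finite C" and card: "card C = 7"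
    using C by (auto simp: C_cover_def maximal_cover_def core_free_cover_def)
  have sub: "subgroup M G" "M \<noteq> carrier G" if "M \<in> C" for M
    using max[OF that] by (simp_all add: maximal_subgroup_def)
  have Un: "\<Union>C = carrier G" using irr by (simp add: irredundant_cover_def is_cover_def)
  have red: "\<Union>C' \<noteq> carrier G" if "C' \<subset> C" for C'
  proof -
    have "\<not> is_cover G C'" using irr that by (simp add: irredundant_cover_def)
    moreover have "\<forall>M\<in>C'. subgroup M G \<and> M \<noteq> carrier G"
      using sub psubset_imp_subset[OF that] by (simp add: subset_eq)
    ultimately show ?thesis by (simp add: is_cover_def)
  qed
  have "C \<noteq> {}" using card by auto
  then have D: "subgroup (\<Inter>C) G" using sub G.subgroups_Inter by blast
  have fin: "finite (carrier G)"
    using G.finite_index_Inter_of_irredundant[OF finC sub(1) Un red]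
      G.finite_of_normal_core_trivial[OF D core] by metis
  have "\<forall>M\<in>C. \<exists>f. f \<in> hom G (integer_mod_group p) \<and> M = {x \<in> carrier G. f x = 0}"
    using G.maximal_subgroup_eq_kernel[OF fin pg] max by metis
  then obtain f where f: "\<And>M. M \<in> C \<Longrightarrow> f M \<in> hom G (integer_mod_group p)"
    and ker: "\<And>M. M \<in> C \<Longrightarrow> M = {x \<in> carrier G. f M x = 0}"
    by metis
  have mem: "f M x = 0 \<longleftrightarrow> x \<in> M" if "M \<in> C" "x \<in> carrier G" for M x
    using ker[OF that(1)] that(2) by blast
  have normal: "M \<lhd> G" if "M \<in> C" for M
    using G.maximal_subgroup_normal[OF fin pg max[OF that]] .
  \<comment> \<open>The cover indexes its own functionals. An element killed by all of them lies in
    every member of the cover; by normality so do its conjugates, which places it in the trivial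
    core.\<close>
  interpret separating_homs G p C f
  proof unfold_locales
    show "finite (carrier G)" "finite C" by fact+
    show "Factorial_Ring.prime p" using pg by (simp add: p_group_def)
    show "f M \<in> hom G (integer_mod_group p)" if "M \<in> C" for M using f that .
    fix x assume x: "x \<in> carrier G" and z: "\<And>M. M \<in> C \<Longrightarrow> f M x = 0"
    have "x \<in> normal_core G (\<Inter>C)"
      unfolding normal_core_def
    proof (intro INT_I)
      fix g assume g: "g \<in> carrier G"
      let ?y = "g \<otimes>\<^bsub>G\<^esub> x \<otimes>\<^bsub>G\<^esub> inv\<^bsub>G\<^esub> g"
      have "?y \<in> \<Inter>C" using normal normal.inv_op_closed2[OF _ g] mem x z by blast
      moreover have "x = inv\<^bsub>G\<^esub> g \<otimes>\<^bsub>G\<^esub> ?y \<otimes>\<^bsub>G\<^esub> g"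
        using g x by (simp add: G.m_assoc G.inv_mult_cancel_left)
      ultimately show "x \<in> (\<lambda>d. inv\<^bsub>G\<^esub> g \<otimes>\<^bsub>G\<^esub> d \<otimes>\<^bsub>G\<^esub> g) ` \<Inter>C" by blast
    qed
    then show "x = \<one>\<^bsub>G\<^esub>" using core by simp
  qed
  have zeros: "zeros x = {M \<in> C. x \<in> M}" if "x \<in> carrier G" for x
    using mem that by (auto simp: zeros_def)
  interpret irredundant_covering_homs G p C f
  proof unfold_locales
    fix x assume "x \<in> carrier G"
    then show "zeros x \<noteq> {}" using zeros Un by auto
  next
    fix M assume M: "M \<in> C"
    \<comment> \<open>A point missed after removing \<open>M\<close> lies in \<open>M\<close>
      alone.\<close>
    have "\<Union>(C - {M}) \<noteq> carrier G" using M by (intro red) auto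
    then obtain x where x: "x \<in> carrier G" "x \<notin> \<Union>(C - {M})" using Un by blast
    then have "zeros x = {M}" using zeros[OF x(1)] Un by auto
    then show "\<exists>x\<in>carrier G. zeros x = {M}" using x(1) by blast
  qed
  have "p < 7" using prime_less card by simp
  moreover have "p \<noteq> 5" by (rule prime_neq_5[OF card])
  moreover have "p \<noteq> 4" "p \<noteq> 6"
    using prime prime_odd_nat[of p] by auto
  ultimately have "p = 2 \<or> p = 3" using p_gt_1 by linarith
  then show ?thesis
    using iso_direct_power_cyclic_2[OF _ card] iso_direct_power_cyclic_3[OF _ card] by blast
qed

theorem theorem1p4:
  fixes G :: "('a, 'b) monoid_scheme"
  assumes "C_group 7 G"
  shows "(\<exists>p. p_group p G) \<longleftrightarrow>
    (G \<cong> direct_power_cyclic 2 6 \<or> G \<cong> direct_power_cyclic 3 4)"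
proof
  assume "\<exists>p. p_group p G"
  then show "G \<cong> direct_power_cyclic 2 6 \<or> G \<cong> direct_power_cyclic 3 4"
    using p_group_C_7[OF assms] by blast
next
  have "group G" using assms by (simp add: C_group_def)
  moreover have "Factorial_Ring.prime (2::nat)" "Factorial_Ring.prime (3::nat)" by simp_all
  moreover assume "G \<cong> direct_power_cyclic 2 6 \<or> G \<cong> direct_power_cyclic 3 4"
  ultimately show "\<exists>p. p_group p G"
    using p_group_iso p_group_direct_power_cyclic by blast
qed

end
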